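(* For any analytic curve in $\mathbb{C}$, spherical arc-length is a global conformal parameter. That is: let $I\subset\mathbb{R}$ be a nonempty interval of arbitrary type which is not a singleton, let $\gamma:I\to\mathbb{C}$ be an analytic curve, let $t_0\in I$, and let $$S(t)=\int_{t_0}^t\frac{|\gamma'(u)|}{1+|\gamma(u)|^2}\,du,\qquad t\in I,$$ be the (signed) spherical arc-length, a strictly increasing continuous function from $I$ onto an interval $S(I)\subset\mathbb{R}$. Then the reparametrized curve $\gamma\circ S^{-1}:S(I)\to\mathbb{C}$ is an analytic curve.
   Context: Definition (analytic curve in $\mathbb{C}$). Let $I\subset\mathbb{R}$ be a nonempty interval of arbitrary type (open, closed, half-open, bounded or not) which is not a singleton. A continuous map $\gamma:I\to\mathbb{C}$ is an analytic curve if $\gamma$ is differentiable on $I$ with $\gamma'(t)\neq 0$ for all $t\in I$ (one-sided derivatives at endpoints belonging to $I$), and for every $t_0\in I$ there exist $\delta_{t_0}>0$ and a power series $\sum_{n=0}^\infty a_n(t-t_0)^n$ with $a_n\in\mathbb{C}$, convergent on $(t_0-\delta_{t_0},t_0+\delta_{t_0})$, such that $\gamma(t)=\sum_{n=0}^\infty a_n(t-t_0)^n$ for all $t\in I\cap(t_0-\delta_{t_0},t_0+\delta_{t_0})$. Saying that an arc-length is a "global conformal parameter" for a curve means that the curve, reparametrized on its whole interval of definition by that arc-length, is again an analytic curve. The arc-length parameter is measured from a base point as a strictly increasing function and is allowed to take negative values. *)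

theory Defs
  imports "HOL-Analysis.Analysis"
begin

definition nondegenerate_interval :: "real set \<Rightarrow> bool" where
  "nondegenerate_interval I \<longleftrightarrow> is_interval I \<and> I \<noteq> {} \<and> \<not> is_singleton I"

(* A curve on I is represented by a total function; its values outside I are irrelevant,
   since the filter "at t within I" gives the one-sided derivative at an endpoint of I. *)
definition analytic_curve :: "real set \<Rightarrow> (real \<Rightarrow> complex) \<Rightarrow> bool" where
  "analytic_curve I \<gamma> \<longleftrightarrow>
     nondegenerate_interval I \<and>
     continuous_on I \<gamma> \<and>
     (\<forall>t\<in>I. \<gamma> differentiable (at t within I) \<and> vector_derivative \<gamma> (at t within I) \<noteq> 0) \<and>
     (\<forall>t0\<in>I. \<exists>\<delta>>0. \<exists>a :: nat \<Rightarrow> complex.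
        (\<forall>t\<in>{t0 - \<delta><..<t0 + \<delta>}. summable (\<lambda>n. a n * of_real (t - t0) ^ n)) \<and>
        (\<forall>t\<in>I \<inter> {t0 - \<delta><..<t0 + \<delta>}. \<gamma> t = (\<Sum>n. a n * of_real (t - t0) ^ n)))"

(* The interval integral is oriented, so this is negative for t < t0. *)
definition spherical_arclength :: "real set \<Rightarrow> (real \<Rightarrow> complex) \<Rightarrow> real \<Rightarrow> real \<Rightarrow> real" where
  "spherical_arclength I \<gamma> t0 t =
     (LBINT u=ereal t0..ereal t. norm (vector_derivative \<gamma> (at u within I)) / (1 + (norm (\<gamma> u))\<^sup>2))"

end

theory Submission
  imports Defs "HOL-Complex_Analysis.Complex_Analysis"
begin

text \<open>
  Near each parameter value, \<open>\<gamma>\<close> is the restriction of a holomorphic function \<open>F\<close>. On the real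
  axis the squared speed is \<open>F' z * cnj (F' (cnj z))\<close>, which is holomorphic in \<open>z\<close>, and likewise
  for \<open>1 + F z * cnj (F (cnj z))\<close>. Hence the spherical speed, and by taking primitives the
  arc-length \<open>S\<close>, extend holomorphically near each point. The extension of \<open>S\<close> has nonzero
  derivative, so it has a local holomorphic inverse \<open>K\<close>, and \<open>F \<circ> K\<close> extends \<open>\<gamma> \<circ> S\<inverse>\<close>.
\<close>

section \<open>Local holomorphic extensions and analytic curves\<close>

text \<open>Agreement is demanded only at points of \<open>I\<close>, while the disc may reach past
  an endpoint; so interior points and endpoints are treated alike.\<close>

definition hol_ext :: "real set \<Rightarrow> (real \<Rightarrow> complex) \<Rightarrow> real \<Rightarrow> real \<Rightarrow> (complex \<Rightarrow> complex) \<Rightarrow> bool"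
  where "hol_ext I f t r F \<longleftrightarrow> 0 < r \<and> F holomorphic_on ball (of_real t) r \<and>
    (\<forall>u\<in>I. dist t u < r \<longrightarrow> F (of_real u) = f u)"

text \<open>Makes \<open>at t within I\<close> a nontrivial filter, so that derivatives within
  \<open>I\<close> are unique, also at endpoints.\<close>

lemma nondegenerate_interval_islimpt:
  assumes "nondegenerate_interval I" "t \<in> I"
  shows "t islimpt I"
proof (rule connected_imp_perfect)
  show "connected I"
    using assms by (simp add: nondegenerate_interval_def is_interval_connected_1)
  show "I \<noteq> {x}" for x
    using assms by (auto simp: nondegenerate_interval_def)
qed fact

lemma hol_ext_has_vector_derivative:
  assumes F: "hol_ext I f t r F" and u: "u \<in> I" "dist t u < r"
  shows "(f has_vector_derivative deriv F (of_real u)) (at u within I)"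
proof (rule has_vector_derivative_transform_within)
  have "(F has_field_derivative deriv F (of_real u)) (at (of_real u))"
    using F u by (intro holomorphic_derivI[of F "ball (of_real t) r"]) (auto simp: hol_ext_def)
  then show "((\<lambda>x. F (of_real x)) has_vector_derivative deriv F (of_real u)) (at u within I)"
    by (rule has_vector_derivative_real_field)
  show "0 < r - dist t u" using u by simp
  show "F (of_real x) = f x" if "x \<in> I" "dist x u < r - dist t u" for x
  proof -
    have "dist t x < r"
      using that dist_triangle[of t x u] by (simp add: dist_commute)
    with F that show ?thesis by (simp add: hol_ext_def)
  qed
qed fact

lemma hol_ext_vector_derivative:
  assumes "nondegenerate_interval I" "hol_ext I f t r F" "u \<in> I" "dist t u < r"
  shows "vector_derivative f (at u within I) = deriv F (of_real u)"
  using assms nondegenerate_interval_islimpt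
  by (intro vector_derivative_within hol_ext_has_vector_derivative)
     (auto simp: trivial_limit_within)

text \<open>Convergence at a real point at distance \<open>p\<close> from the centre forces
  convergence at every complex point closer than \<open>p\<close>, so convergence on the real
  interval spreads to the whole disc of radius \<open>d\<close>.\<close>

lemma hol_ext_power_series:
  assumes d: "0 < d"
    and sm: "\<And>u. u \<in> {t - d<..<t + d} \<Longrightarrow> summable (\<lambda>n. a n * complex_of_real (u - t) ^ n)"
    and eq: "\<And>u. u \<in> I \<inter> {t - d<..<t + d} \<Longrightarrow> f u = (\<Sum>n. a n * complex_of_real (u - t) ^ n)"
  shows "hol_ext I f t d (\<lambda>w. \<Sum>n. a n * (w - of_real t) ^ n)"
proof -
  have "(\<lambda>w. \<Sum>n. a n * (w - of_real t) ^ n) holomorphic_on ball (of_real t) d"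
  proof (rule power_series_holomorphic)
    fix w :: complex
    assume w: "w \<in> ball (of_real t) d"
    \<comment> \<open>The midpoint between the distance of \<open>w\<close> from the centre and
      \<open>d\<close>: the real point \<open>t + p\<close> is still in the interval but farther out
      than \<open>w\<close>.\<close>
    define p where "p = (norm (w - of_real t) + d) / 2"
    have p: "norm (w - of_real t) < p" "p < d" "0 < p"
      using w add_nonneg_pos[OF norm_ge_zero d, of "w - of_real t"]
      by (simp_all add: p_def dist_norm norm_minus_commute)
    have "summable (\<lambda>n. a n * complex_of_real p ^ n)"
      using sm[of "t + p"] p by simp
    then have "summable (\<lambda>n. a n * (w - of_real t) ^ n)"
      by (rule powser_inside) (use p in simp)
    then show "(\<lambda>n. a n * (w - of_real t) ^ n) sums (\<Sum>n. a n * (w - of_real t) ^ n)"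
      by (rule summable_sums)
  qed
  moreover have "u \<in> {t - d<..<t + d}" if "dist t u < d" for u
    using that by (auto simp: dist_real_def)
  ultimately show ?thesis
    using d eq by (simp add: hol_ext_def)
qed

text \<open>Replaces power series by holomorphic functions, so that products, square roots,
  primitives and inverses become available. Differentiability and continuity of the curve follow
  from the extensions, and regularity is read off at the centre of each disc.\<close>

lemma analytic_curve_iff_hol_ext:
  "analytic_curve I \<gamma> \<longleftrightarrow> nondegenerate_interval I \<and>
    (\<forall>t\<in>I. \<exists>r F. hol_ext I \<gamma> t r F \<and> deriv F (of_real t) \<noteq> 0)"
proof safe
  assume A: "analytic_curve I \<gamma>"
  then show I: "nondegenerate_interval I" by (simp add: analytic_curve_def)
  fix t assume t: "t \<in> I"
  with A obtain d a where d: "d > 0"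
    and "\<forall>u\<in>{t - d<..<t + d}. summable (\<lambda>n. a n * complex_of_real (u - t) ^ n)"
    and "\<forall>u\<in>I \<inter> {t - d<..<t + d}. \<gamma> u = (\<Sum>n. a n * complex_of_real (u - t) ^ n)"
    unfolding analytic_curve_def by meson
  then have F: "hol_ext I \<gamma> t d (\<lambda>w. \<Sum>n. a n * (w - of_real t) ^ n)" (is "hol_ext _ _ _ _ ?F")
    by (intro hol_ext_power_series) auto
  have "vector_derivative \<gamma> (at t within I) = deriv ?F (of_real t)"
    using hol_ext_vector_derivative[OF I F t] d by simp
  with A t have "deriv ?F (of_real t) \<noteq> 0" unfolding analytic_curve_def by metis
  with F show "\<exists>r F. hol_ext I \<gamma> t r F \<and> deriv F (of_real t) \<noteq> 0" by blast
next
  assume I: "nondegenerate_interval I"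
    and ex: "\<forall>t\<in>I. \<exists>r F. hol_ext I \<gamma> t r F \<and> deriv F (of_real t) \<noteq> 0"
  have D: "\<gamma> differentiable (at t within I) \<and> vector_derivative \<gamma> (at t within I) \<noteq> 0"
    if t: "t \<in> I" for t
  proof -
    obtain r F where F: "hol_ext I \<gamma> t r F" "deriv F (of_real t) \<noteq> 0" using ex t by blast
    then have "dist t t < r" by (simp add: hol_ext_def)
    with F t I show ?thesis
      using hol_ext_has_vector_derivative hol_ext_vector_derivative differentiableI_vector by metis
  qed
  moreover from D have "continuous_on I \<gamma>"
    by (simp add: continuous_on_eq_continuous_within differentiable_imp_continuous_within)
  moreover have "\<exists>\<delta>>0. \<exists>a :: nat \<Rightarrow> complex.
        (\<forall>u\<in>{t - \<delta><..<t + \<delta>}. summable (\<lambda>n. a n * of_real (u - t) ^ n)) \<and>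
        (\<forall>u\<in>I \<inter> {t - \<delta><..<t + \<delta>}. \<gamma> u = (\<Sum>n. a n * of_real (u - t) ^ n))"
    if t: "t \<in> I" for t
  proof -
    obtain r F where F: "hol_ext I \<gamma> t r F" using ex t by blast
    \<comment> \<open>Taylor coefficients of \<open>F\<close> at \<open>t\<close>; the series
      converges on the whole disc, so \<open>r\<close> itself serves as the radius.\<close>
    define a where "a n = (deriv ^^ n) F (of_real t) / fact n" for n
    have *: "(\<lambda>n. a n * of_real (u - t) ^ n) sums F (of_real u)" if "u \<in> {t - r<..<t + r}" for u
    proof -
      have "complex_of_real u \<in> ball (of_real t) r" using that by (auto simp: dist_real_def)
      with F show ?thesis
        using holomorphic_power_series[of F "of_real t" r "of_real u"]
        by (simp add: hol_ext_def a_def)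
    qed
    have "\<gamma> u = F (of_real u)" if "u \<in> I \<inter> {t - r<..<t + r}" for u
      using that F by (auto simp: hol_ext_def dist_real_def)
    moreover have "r > 0" using F by (simp add: hol_ext_def)
    ultimately show ?thesis
      using * by (intro exI[of _ r] conjI exI[of _ a] ballI) (simp_all add: sums_iff)
  qed
  ultimately show "analytic_curve I \<gamma>"
    using I by (simp add: analytic_curve_def)
qed

section \<open>Holomorphic extension of the spherical speed\<close>

definition spherical_speed :: "real set \<Rightarrow> (real \<Rightarrow> complex) \<Rightarrow> real \<Rightarrow> real" where
  "spherical_speed I \<gamma> u =
     norm (vector_derivative \<gamma> (at u within I)) / (1 + (norm (\<gamma> u))\<^sup>2)"

lemma spherical_speed_pos:
  assumes "analytic_curve I \<gamma>" "t \<in> I"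
  shows "spherical_speed I \<gamma> t > 0"
  unfolding spherical_speed_def
  by (intro divide_pos_pos add_pos_nonneg) (use assms in \<open>auto simp: analytic_curve_def\<close>)

text \<open>The extension of the squared speed has a holomorphic square root near \<open>t\<close>,
  because its value at \<open>t\<close> is positive by regularity of the curve.\<close>

lemma spherical_speed_hol_ext:
  assumes A: "analytic_curve I \<gamma>" and t: "t \<in> I"
  shows "\<exists>r G. hol_ext I (\<lambda>u. of_real (spherical_speed I \<gamma> u)) t r G"
proof -
  have I: "nondegenerate_interval I" using A by (simp add: analytic_curve_def)
  obtain r F where F: "hol_ext I \<gamma> t r F" "deriv F (of_real t) \<noteq> 0"
    using A t by (auto simp: analytic_curve_iff_hol_ext)
  define B where "B = ball (complex_of_real t) r"
  have r: "r > 0" and FB: "F holomorphic_on B" using F by (simp_all add: hol_ext_def B_def)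
  have dFB: "deriv F holomorphic_on B" using FB by (auto intro: holomorphic_deriv simp: B_def)
  \<comment> \<open>The centre of \<open>B\<close> is real, so conjugating both argument and value
    gives another holomorphic function on the same disc.\<close>
  have cnjB: "cnj ` B = B"
  proof -
    have "cnj z \<in> B" if "z \<in> B" for z
      using that unfolding B_def by (metis complex_cnj_complex_of_real complex_cnj_diff complex_mod_cnj dist_norm mem_ball)
    then show ?thesis
      by (metis (no_types) complex_cnj_cnj image_eqI image_subsetI subsetI subset_antisym)
  qed
  have conj_hol: "(\<lambda>z. cnj (f (cnj z))) holomorphic_on B" if "f holomorphic_on B" for f
    using holomorphic_on_compose_cnj_cnj[of f B] that cnjB by (simp add: o_def B_def)
  define N where "N z = deriv F z * cnj (deriv F (cnj z))" for z
  define M where "M z = 1 + F z * cnj (F (cnj z))" for z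
  have hol: "N holomorphic_on B" "M holomorphic_on B"
    unfolding N_def M_def by (intro holomorphic_intros conj_hol FB dFB)+
  have Nreal: "N (of_real u) = of_real ((norm (deriv F (of_real u)))\<^sup>2)" for u
    unfolding N_def by (metis complex_cnj_complex_of_real complex_norm_square of_real_power)
  have Mreal: "M (of_real u) = of_real (1 + (norm (F (of_real u)))\<^sup>2)" for u
    unfolding M_def
    by (metis complex_cnj_complex_of_real complex_norm_square of_real_1 of_real_add of_real_power)
  \<comment> \<open>Open conditions that hold at the centre: the first keeps \<open>N\<close> off
    the branch cut of \<open>csqrt\<close>, the second keeps the denominator from vanishing.\<close>
  have "\<forall>\<^sub>F z in nhds (of_real t). Re (N z) > 0 \<and> Re (M z) > 0 \<and> z \<in> B"
  proof (intro eventually_conj)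
    have c: "isCont N (of_real t)" "isCont M (of_real t)"
      using hol r by (auto simp: B_def intro: holomorphic_on_imp_continuous_on continuous_on_interior)
    have "Re (N (of_real t)) > 0" using F by (simp add: Nreal)
    moreover have "Re (M (of_real t)) > 0" by (simp add: Mreal add_pos_nonneg)
    ultimately show "\<forall>\<^sub>F z in nhds (of_real t). Re (N z) > 0" "\<forall>\<^sub>F z in nhds (of_real t). Re (M z) > 0"
      using c by (auto intro!: order_tendstoD tendsto_Re simp: isCont_def tendsto_at_iff_tendsto_nhds)
    show "\<forall>\<^sub>F z in nhds (of_real t). z \<in> B"
      using r by (intro eventually_nhds_in_open) (auto simp: B_def)
  qed
  then obtain q where q: "q > 0"
    and pos: "\<And>z. z \<in> ball (of_real t) q \<Longrightarrow> Re (N z) > 0 \<and> Re (M z) > 0 \<and> z \<in> B"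
    unfolding eventually_nhds_metric by (metis dist_commute mem_ball)
  have "(\<lambda>z. csqrt (N z) / M z) holomorphic_on ball (of_real t) q"
  proof (intro holomorphic_intros)
    show "N holomorphic_on ball (of_real t) q" "M holomorphic_on ball (of_real t) q"
      using pos by (auto intro: holomorphic_on_subset hol)
    fix z assume "z \<in> ball (complex_of_real t) q"
    from pos[OF this] show "N z \<notin> \<real>\<^sub>\<le>\<^sub>0" "M z \<noteq> 0"
      by (auto simp: complex_nonpos_Reals_iff)
  qed
  moreover have "csqrt (N (of_real u)) / M (of_real u) = of_real (spherical_speed I \<gamma> u)"
    if u: "u \<in> I" "dist t u < q" for u
  proof -
    have "complex_of_real u \<in> B" using pos[of "of_real u"] u by simp
    then have d: "dist t u < r" by (simp add: B_def)
    \<comment> \<open>The principal root of a nonnegative real is its nonnegative root, so the norm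
      appears with the right sign.\<close>
    have "csqrt (N (of_real u)) = of_real (norm (deriv F (of_real u)))"
      by (simp only: Nreal csqrt_of_real_nonneg zero_le_power2) simp
    moreover have "F (of_real u) = \<gamma> u" using F u d by (simp add: hol_ext_def)
    ultimately show ?thesis
      using hol_ext_vector_derivative[OF I F(1) u(1) d]
      by (simp add: spherical_speed_def Mreal)
  qed
  ultimately have "hol_ext I (\<lambda>u. of_real (spherical_speed I \<gamma> u)) t q (\<lambda>z. csqrt (N z) / M z)"
    using q by (simp add: hol_ext_def)
  then show ?thesis by blast
qed

text \<open>Used for both the speed and the arc-length: the complex-valued copy is differentiable
  within \<open>I\<close>, hence continuous, and taking real parts returns to
  \<open>f\<close>.\<close>

lemma hol_ext_continuous_on:
  assumes "\<And>t. t \<in> I \<Longrightarrow> \<exists>r F. hol_ext I (\<lambda>u. of_real (f u)) t r F"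
  shows "continuous_on I f"
proof -
  have "continuous_on I (\<lambda>u. complex_of_real (f u))"
    unfolding continuous_on_eq_continuous_within
  proof
    fix t assume t: "t \<in> I"
    then obtain r F where F: "hol_ext I (\<lambda>u. of_real (f u)) t r F" using assms by blast
    then have "dist t t < r" by (simp add: hol_ext_def)
    with F t show "continuous (at t within I) (\<lambda>u. complex_of_real (f u))"
      by (blast intro: has_vector_derivative_continuous hol_ext_has_vector_derivative)
  qed
  from continuous_on_Re[OF this] show ?thesis by simp
qed

lemma spherical_speed_continuous_on:
  assumes "analytic_curve I \<gamma>"
  shows "continuous_on I (spherical_speed I \<gamma>)"
  by (rule hol_ext_continuous_on) (rule spherical_speed_hol_ext[OF assms])

section \<open>Spherical arc-length as a primitive of the speed\<close>

lemma Icc_subset_interval: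
  fixes I :: "real set"
  assumes "is_interval I" "a \<in> I" "b \<in> I"
  shows "{a..b} \<subseteq> I"
  using assms unfolding is_interval_1 by (meson atLeastAtMost_iff subsetI)

text \<open>Additivity of the oriented integral, for the three points in any order; it moves the
  base point from \<open>t0\<close> to wherever the local argument takes place.\<close>

lemma spherical_arclength_diff:
  assumes A: "analytic_curve I \<gamma>" and t: "t0 \<in> I" "t \<in> I" "u \<in> I"
  shows "spherical_arclength I \<gamma> t0 u - spherical_arclength I \<gamma> t0 t =
    (LBINT x=ereal t..ereal u. spherical_speed I \<gamma> x)"
proof -
  \<comment> \<open>The smallest closed interval containing all three points; integrability over it
    is what additivity requires.\<close>
  let ?a = "min t0 (min t u)" and ?b = "max t0 (max t u)"
  have "?a \<in> I" "?b \<in> I" using t by (auto simp: min_def max_def)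
  moreover have "is_interval I"
    using A by (auto simp: analytic_curve_def nondegenerate_interval_def)
  ultimately have "{?a..?b} \<subseteq> I" by (intro Icc_subset_interval)
  then have "continuous_on {?a..?b} (spherical_speed I \<gamma>)"
    by (rule continuous_on_subset[OF spherical_speed_continuous_on[OF A]])
  then have "interval_lebesgue_integrable lborel (ereal ?a) (ereal ?b) (spherical_speed I \<gamma>)"
    by (rule interval_integrable_continuous_on[rotated]) simp
  then have "interval_lebesgue_integrable lborel (min (ereal t0) (min (ereal t) (ereal u)))
      (max (ereal t0) (max (ereal t) (ereal u))) (spherical_speed I \<gamma>)"
    by (simp only: ereal_min ereal_max)
  then have "(LBINT x=ereal t0..ereal t. spherical_speed I \<gamma> x)
      + (LBINT x=ereal t..ereal u. spherical_speed I \<gamma> x)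
      = (LBINT x=ereal t0..ereal u. spherical_speed I \<gamma> x)"
    by (rule interval_integral_sum)
  then show ?thesis
    unfolding spherical_arclength_def spherical_speed_def by (simp only: add_diff_cancel_left')
qed

text \<open>A primitive of the extended speed on the disc, suitably normalized, extends the
  arc-length; its derivative at \<open>t\<close> is the speed, which is positive.\<close>

lemma spherical_arclength_hol_ext:
  assumes A: "analytic_curve I \<gamma>" and t: "t0 \<in> I" "t \<in> I"
  shows "\<exists>r H. hol_ext I (\<lambda>u. of_real (spherical_arclength I \<gamma> t0 u)) t r H \<and>
    deriv H (of_real t) \<noteq> 0"
proof -
  let ?\<sigma> = "spherical_speed I \<gamma>" and ?S = "spherical_arclength I \<gamma> t0"
  have I: "is_interval I"
    using A by (auto simp: analytic_curve_def nondegenerate_interval_def)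
  obtain r G where G: "hol_ext I (\<lambda>u. of_real (?\<sigma> u)) t r G"
    using spherical_speed_hol_ext[OF A t(2)] by blast
  define B where "B = ball (complex_of_real t) r"
  have r: "r > 0" using G by (simp add: hol_ext_def)
  obtain g where "\<And>z. z \<in> B \<Longrightarrow> (g has_field_derivative G z) (at z within B)"
    using holomorphic_convex_primitive'[of B G] G by (auto simp: hol_ext_def B_def)
  then have g: "(g has_field_derivative G z) (at z)" if "z \<in> B" for z
    using that by (metis B_def at_within_open open_ball)
  \<comment> \<open>The constants are chosen so that \<open>H\<close> takes the value
    \<open>?S t\<close> at the centre.\<close>
  define H where "H z = g z - g (of_real t) + of_real (?S t)" for z
  have H: "(H has_field_derivative G z) (at z)" if "z \<in> B" for z
    unfolding H_def using g[OF that] by (auto intro!: derivative_eq_intros)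
  have "H (of_real u) = of_real (?S u)" if u: "u \<in> I" "dist t u < r" for u
  proof -
    let ?J = "{min t u..max t u}"
    have J: "?J \<subseteq> I" using t u I by (intro Icc_subset_interval) (auto simp: min_def max_def)
    have J': "complex_of_real x \<in> B \<and> G (of_real x) = of_real (?\<sigma> x)" if "x \<in> ?J" for x
    proof -
      have "dist t x < r" using that u by (auto simp: dist_real_def min_def max_def split: if_splits)
      with G J that show ?thesis by (auto simp: hol_ext_def B_def)
    qed
    \<comment> \<open>Both sides of the fundamental theorem are oriented, so \<open>u\<close> may
      lie on either side of \<open>t\<close>.\<close>
    have "complex_of_real (?S u - ?S t) = (LBINT x=ereal t..ereal u. complex_of_real (?\<sigma> x))"
      by (simp only: spherical_arclength_diff[OF A t u(1)] interval_lebesgue_integral_of_real)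
    also have "\<dots> = g (of_real u) - g (of_real t)"
    proof (rule interval_integral_FTC_finite)
      show "continuous_on ?J (\<lambda>x. complex_of_real (?\<sigma> x))"
        using spherical_speed_continuous_on[OF A] J
        by (intro continuous_on_of_real) (rule continuous_on_subset)
      show "((\<lambda>x. g (complex_of_real x)) has_vector_derivative complex_of_real (?\<sigma> x)) (at x within ?J)"
        if "min t u \<le> x" "x \<le> max t u" for x
      proof -
        have "(g has_field_derivative of_real (?\<sigma> x)) (at (of_real x))"
          using J'[of x] g[of "of_real x"] that by simp
        then show ?thesis by (rule has_vector_derivative_real_field)
      qed
    qed
    finally show ?thesis by (simp add: H_def algebra_simps)
  qed
  moreover have "H holomorphic_on B"
    using H by (auto simp: holomorphic_on_def field_differentiable_def intro: DERIV_subset)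
  moreover have "deriv H (of_real t) = of_real (?\<sigma> t)"
    using H[of "of_real t"] r G t(2) by (auto simp: B_def hol_ext_def intro: DERIV_imp_deriv)
  ultimately have "hol_ext I (\<lambda>u. of_real (?S u)) t r H \<and> deriv H (of_real t) \<noteq> 0"
    using r spherical_speed_pos[OF A t(2)] by (simp add: hol_ext_def B_def)
  then show ?thesis by blast
qed

text \<open>With the base point moved to \<open>u\<close>, the arc-length up to \<open>x\<close> has
  the positive speed as its derivative.\<close>

lemma spherical_arclength_strict_mono_on:
  assumes A: "analytic_curve I \<gamma>" and t: "t0 \<in> I"
  shows "strict_mono_on I (spherical_arclength I \<gamma> t0)"
proof (rule strict_mono_onI)
  fix u v assume uv: "u \<in> I" "v \<in> I" "u < v"
  let ?P = "\<lambda>x. LBINT y=ereal u..ereal x. spherical_speed I \<gamma> y"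
  have J: "{u..v} \<subseteq> I"
    using A uv by (intro Icc_subset_interval) (auto simp: analytic_curve_def nondegenerate_interval_def)
  have P: "(?P has_vector_derivative spherical_speed I \<gamma> x) (at x within {u..v})" if "x \<in> {u..v}" for x
    using uv that spherical_speed_continuous_on[OF A] J
    by (intro interval_integral_FTC2) (auto intro: continuous_on_subset)
  have "?P u < ?P v"
  \<comment> \<open>Two-sided derivatives are asked for only strictly between \<open>u\<close> and
    \<open>v\<close>; at the ends, where \<open>I\<close> may stop, continuity suffices.\<close>
  proof (rule DERIV_pos_imp_increasing_open[OF \<open>u < v\<close>])
    fix x assume x: "u < x" "x < v"
    then have "DERIV ?P x :> spherical_speed I \<gamma> x"
      using P[of x] by (simp add: at_within_Icc_at has_real_derivative_iff_has_vector_derivative)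
    moreover have "x \<in> I" using x J by auto
    ultimately show "\<exists>y. DERIV ?P x :> y \<and> y > 0"
      using spherical_speed_pos[OF A] by blast
  next
    show "continuous_on {u..v} ?P"
      unfolding continuous_on_eq_continuous_within
      using P has_vector_derivative_continuous by blast
  qed
  then show "spherical_arclength I \<gamma> t0 u < spherical_arclength I \<gamma> t0 v"
    using spherical_arclength_diff[OF A t uv(1,2)] by simp
qed

section \<open>Reparametrization by spherical arc-length\<close>

theorem theorem2p7:
  fixes I :: "real set" and \<gamma> :: "real \<Rightarrow> complex" and t0 :: real
  assumes "nondegenerate_interval I"
    and "analytic_curve I \<gamma>"
    and "t0 \<in> I"
  defines "S \<equiv> spherical_arclength I \<gamma> t0"
  shows "strict_mono_on I S \<and> continuous_on I S \<and> is_interval (S ` I) \<and>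
    analytic_curve (S ` I) (\<gamma> \<circ> inv_into I S)"
proof -
  have mono: "strict_mono_on I S"
    unfolding S_def using assms by (intro spherical_arclength_strict_mono_on)
  then have inj: "inj_on S I" by (rule strict_mono_on_imp_inj_on)
  have cont: "continuous_on I S"
    unfolding S_def using spherical_arclength_hol_ext assms by (intro hol_ext_continuous_on) blast
  have I: "is_interval I" "I \<noteq> {}" "\<not> is_singleton I"
    using assms by (simp_all add: nondegenerate_interval_def)
  have int: "is_interval (S ` I)"
    using I cont by (simp add: is_interval_connected_1 connected_continuous_image)
  have nd: "nondegenerate_interval (S ` I)"
    using I int inj by (auto simp: nondegenerate_interval_def is_singleton_altdef card_image)
  define T where "T = inv_into I S"
  have TS: "T (S u) = u" if "u \<in> I" for u using that inj by (simp add: T_def)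
  \<comment> \<open>A continuous injection of an interval into the reals is a homeomorphism onto its
    image, and its continuous inverse agrees there with \<open>T\<close>.\<close>
  have contT: "continuous_on (S ` I) T"
  proof -
    obtain g where g: "homeomorphism I (S ` I) S g"
      using homeomorphism_into_1d[of I S] I cont inj is_interval_path_connected_1 by blast
    have "g s = T s" if "s \<in> S ` I" for s
      using that g TS by (auto simp: homeomorphism_def)
    with g show ?thesis by (metis continuous_on_cong homeomorphism_cont2)
  qed
  have "\<exists>r K. hol_ext (S ` I) (\<gamma> \<circ> T) (S t) r K \<and> deriv K (of_real (S t)) \<noteq> 0" if t: "t \<in> I" for t
  proof -
    obtain r F where F: "hol_ext I \<gamma> t r F" "deriv F (of_real t) \<noteq> 0"
      using assms t by (auto simp: analytic_curve_iff_hol_ext)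
    obtain q H where H: "hol_ext I (\<lambda>u. of_real (S u)) t q H" "deriv H (of_real t) \<noteq> 0"
      using spherical_arclength_hol_ext assms t unfolding S_def by blast
    define B where "B = ball (complex_of_real t) (min r q)"
    have rq: "r > 0" "q > 0" using F H by (simp_all add: hol_ext_def)
    have "F holomorphic_on B" "H holomorphic_on B"
      using F H by (auto simp: hol_ext_def B_def intro: holomorphic_on_subset)
    \<comment> \<open>The inverse function theorem: since \<open>deriv H\<close> is nonzero at
      \<open>t\<close>, \<open>H\<close> is injective with open image on a small disc.\<close>
    obtain p where p: "p > 0" "ball (of_real t) p \<subseteq> B" "open (H ` ball (of_real t) p)"
      "inj_on H (ball (of_real t) p)"
      using has_complex_derivative_locally_invertible[OF \<open>H holomorphic_on B\<close> _ _ H(2)] rq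
      by (auto simp: B_def)
    have Hp: "H holomorphic_on ball (of_real t) p" and Fp: "F holomorphic_on ball (of_real t) p"
      using p \<open>F holomorphic_on B\<close> \<open>H holomorphic_on B\<close> by (auto intro: holomorphic_on_subset)
    obtain K where K: "K holomorphic_on H ` ball (of_real t) p"
      and dK: "\<And>z. z \<in> ball (of_real t) p \<Longrightarrow> deriv H z * deriv K (H z) = 1"
      and KH: "\<And>z. z \<in> ball (of_real t) p \<Longrightarrow> K (H z) = z"
      using holomorphic_has_inverse[OF Hp _ p(4)] by auto
    have Hreal: "H (of_real u) = of_real (S u)" and Freal: "F (of_real u) = \<gamma> u"
      if "u \<in> I" "dist t u < p" for u
    proof -
      have "complex_of_real u \<in> B" using p that by (auto intro!: subsetD[OF p(2)])
      with F H that show "H (of_real u) = of_real (S u)" "F (of_real u) = \<gamma> u"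
        by (auto simp: hol_ext_def B_def)
    qed
    have tp: "complex_of_real t \<in> ball (of_real t) p" and Ht: "H (of_real t) = of_real (S t)"
      using p Hreal t by simp_all
    \<comment> \<open>\<open>e1\<close> keeps the disc about \<open>S t\<close> inside the domain of
      the local inverse \<open>K\<close>.\<close>
    obtain e1 where e1: "e1 > 0" "ball (of_real (S t)) e1 \<subseteq> H ` ball (of_real t) p"
      using p(3) tp Ht by (metis image_eqI open_contains_ball)
    \<comment> \<open>\<open>e2\<close> ties \<open>K\<close> to the global inverse: continuity of
      \<open>T\<close> keeps \<open>T s\<close> in the disc where \<open>H\<close> is inverted, so
      \<open>K\<close> and \<open>T\<close> agree at \<open>s\<close>.\<close>
    obtain e2 where e2: "e2 > 0" "\<And>s. s \<in> S ` I \<Longrightarrow> dist s (S t) < e2 \<Longrightarrow> dist (T s) (T (S t)) < p"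
      using contT t p(1) unfolding continuous_on_iff by (meson imageI)
    have "hol_ext (S ` I) (\<gamma> \<circ> T) (S t) (min e1 e2) (F \<circ> K)"
      unfolding hol_ext_def
    proof (intro conjI ballI impI)
      have "(F \<circ> K) holomorphic_on H ` ball (of_real t) p"
        using K Fp KH by (intro holomorphic_on_compose_gen[where t = "ball (of_real t) p"]) auto
      then show "(F \<circ> K) holomorphic_on ball (of_real (S t)) (min e1 e2)"
        by (rule holomorphic_on_subset) (use e1 in auto)
      fix s assume s: "s \<in> S ` I" "dist (S t) s < min e1 e2"
      then obtain u where u: "u \<in> I" "s = S u" by blast
      have "dist t u < p"
        using e2(2)[of s] s u t by (simp add: TS dist_commute)
      then show "(F \<circ> K) (of_real s) = (\<gamma> \<circ> T) s"
        using u Hreal[of u] Freal[of u] KH[of "of_real u"] by (simp add: TS)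
    qed (use e1 e2 in auto)
    \<comment> \<open>By the chain rule this is \<open>deriv F\<close> at \<open>t\<close> divided
      by \<open>deriv H\<close> at \<open>t\<close>.\<close>
    moreover have "deriv (F \<circ> K) (of_real (S t)) \<noteq> 0"
    proof -
      have "K field_differentiable at (of_real (S t))"
        using K p(3) tp Ht by (metis holomorphic_on_imp_differentiable_at image_eqI)
      moreover have Kt: "K (of_real (S t)) = of_real t" using KH[OF tp] Ht by simp
      moreover have "F field_differentiable at (of_real t)"
        using Fp tp holomorphic_on_imp_differentiable_at by blast
      ultimately have "deriv (F \<circ> K) (of_real (S t)) = deriv F (of_real t) * deriv K (of_real (S t))"
        by (simp add: deriv_chain)
      moreover have "deriv K (of_real (S t)) \<noteq> 0" using dK[OF tp] Ht by auto
      ultimately show ?thesis using F by simp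
    qed
    ultimately show ?thesis by blast
  qed
  with nd have "analytic_curve (S ` I) (\<gamma> \<circ> T)"
    by (auto simp: analytic_curve_iff_hol_ext)
  with mono cont int show ?thesis by (simp add: T_def)
qed

end
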